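(* Let $s\in\mathbb{F}_q$ be such that $c := 1-s^2 \in \mathcal{C}$, and let $x$ be any zero of $g_s(y)$ (in an algebraic closure of $\mathbb{F}_q$) of degree $d>2$ over $\mathbb{F}_q$. Then $I_x(y) := N(y)-N(x)$ is the monic irreducible polynomial of $x$ over $\mathbb{F}_q$.
   Context: $\mathbb{F}_q$ is a finite field with $q$ elements, $q$ a power of an odd prime; $n=(q+1)/2$; for $s\in\mathbb{F}_q$, $g_s(y) := y^n+(1-y)^n-s \in \mathbb{F}_q[y]$. $\rho$ is the quadratic character on $\mathbb{F}_q$ (with $\rho(0)=0$), and $\mathcal{C} := \{a \in \mathbb{F}_q : \rho(a)=\rho(1-a)=1\}$. For $c\in\mathcal{C}$, $\langle c_k\rangle_{k\in\mathbb{Z}}$ is the bilateral sequence in $\mathbb{F}_q$ defined by $c_0=0$, $c_1=c$, and $c_{k+1}=(2-4c)c_k-c_{k-1}+2c$ for all $k\in\mathbb{Z}$. The monic polynomial $N(y)\in\mathbb{F}_q[y]$ of degree $d$ is defined by $$N(y) := y\prod_{k=1}^{(d-1)/2}(y-c_k)^2 \ \text{ if } d \text{ is odd}, \qquad N(y) := (y^2-y)\prod_{k=1}^{(d-2)/2}(y-c_k)^2 \ \text{ if } d \text{ is even}.$$ The degree of an algebraic element over $\mathbb{F}_q$ is the degree of its minimal polynomial. *)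

theory Defs
  imports
    "HOL-Algebra.Algebraic_Closure_Type"
    "HOL-Library.Cardinality"
begin

text \<open>
  The finite field with \<open>q\<close> elements is a type \<open>'a\<close> of classes \<open>field\<close> and \<open>finite\<close> with
  \<open>CARD('a) = q\<close>; its algebraic closure is \<open>'a alg_closure\<close>, with embedding \<open>to_ac\<close>.
  Names that also exist in HOL-Algebra are qualified so as to denote the notions of
  HOL-Computational\<open>_\<close>Algebra.
\<close>

subsection \<open>Elements of the algebraic closure\<close>

abbreviation poly_ac :: "'a :: field poly \<Rightarrow> 'a alg_closure \<Rightarrow> 'a alg_closure" where
  "poly_ac p x \<equiv> poly (map_poly to_ac p) x"

text \<open>The definite description is justified by \<open>ex1_monic_irreducible\<close> below.\<close>

definition min_poly :: "'a :: field alg_closure \<Rightarrow> 'a poly" where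
  "min_poly x =
     (THE p. Polynomial.lead_coeff p = 1 \<and> Factorial_Ring.irreducible p \<and> poly_ac p x = 0)"

definition ac_degree :: "'a :: field alg_closure \<Rightarrow> nat" where
  "ac_degree x = Polynomial.degree (min_poly x)"

lemma map_poly_to_ac_add: "map_poly to_ac (p + q) = map_poly to_ac p + map_poly to_ac q"
  by (rule poly_eqI) (simp add: coeff_map_poly)

lemma map_poly_to_ac_mult: "map_poly to_ac (p * q) = map_poly to_ac p * map_poly to_ac q"
  by (rule poly_eqI) (simp add: coeff_map_poly coeff_mult to_ac_sum)

lemma ex1_monic_irreducible:
  fixes x :: "'a :: field alg_closure"
  shows "\<exists>!p :: 'a poly. Polynomial.lead_coeff p = 1 \<and> Factorial_Ring.irreducible p \<and> poly_ac p x = 0"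
proof -
  define A where "A = {p :: 'a poly. p \<noteq> 0 \<and> poly_ac p x = 0}"
  have "A \<noteq> {}"
    using alg_closure_algebraic[of x] unfolding A_def by blast
  then obtain m where m: "m \<in> A" and
    least: "\<And>p. p \<in> A \<Longrightarrow> Polynomial.degree m \<le> Polynomial.degree p"
    using ex_has_least_nat[of "\<lambda>p. p \<in> A" _ Polynomial.degree] by blast
  have m0: "m \<noteq> 0" and mx: "poly_ac m x = 0"
    using m by (auto simp: A_def)
  have dvd: "m dvd p" if "poly_ac p x = 0" for p
  proof -
    have "map_poly to_ac p =
        map_poly to_ac (p div m) * map_poly to_ac m + map_poly to_ac (p mod m)"
      by (simp flip: map_poly_to_ac_add map_poly_to_ac_mult)
    hence "poly_ac (p mod m) x = 0"
      using that mx by simp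
    hence "p mod m \<in> A" if "p mod m \<noteq> 0"
      using that by (simp add: A_def)
    with least[of "p mod m"] degree_mod_less[OF m0, of p] have "p mod m = 0"
      by linarith
    thus ?thesis by (simp add: mod_eq_0_iff_dvd)
  qed
  have not_unit: "\<not> is_unit p" if "poly_ac p x = 0" for p
  proof
    assume "is_unit p"
    then obtain c where "p = [:c:]" "c \<noteq> 0"
      by (auto simp: is_unit_poly_iff dvd_field_iff)
    with that show False by (simp add: map_poly_pCons)
  qed
  define c where "c = Polynomial.lead_coeff m"
  define m' where "m' = smult (inverse c) m"
  have c0: "c \<noteq> 0" using m0 by (simp add: c_def)
  have m'0: "m' \<noteq> 0" using m0 c0 by (simp add: m'_def)
  have lc: "Polynomial.lead_coeff m' = 1"
    using c0 by (simp add: m'_def c_def)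
  have m'x: "poly_ac m' x = 0"
    using mx map_poly_to_ac_mult[of "[:inverse c:]" m] by (simp add: m'_def)
  have deg': "Polynomial.degree m' = Polynomial.degree m"
    using c0 by (simp add: m'_def)
  have dvd': "m' dvd p" if "poly_ac p x = 0" for p
    using dvd[OF that] c0 by (simp add: m'_def smult_dvd_iff)
  have factor: "is_unit b" if "m' = a * b" "poly_ac a x = 0" for a b
  proof -
    from dvd'[OF that(2)] obtain e where "a = m' * e" by (elim dvdE)
    with that(1) have "m' * 1 = m' * (b * e)" by (simp add: mult_ac)
    hence "1 = b * e"
      using mult_left_cancel[OF m'0, of 1 "b * e"] by blast
    thus ?thesis by (rule dvdI)
  qed
  have irr: "Factorial_Ring.irreducible m'"
  proof (rule Factorial_Ring.irreducibleI)
    show "m' \<noteq> 0" by (fact m'0)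
    show "\<not> is_unit m'" by (rule not_unit[OF m'x])
    fix a b assume ab: "m' = a * b"
    hence "poly_ac a x = 0 \<or> poly_ac b x = 0"
      using m'x map_poly_to_ac_mult[of a b] by simp
    thus "is_unit a \<or> is_unit b"
      using factor[of a b] factor[of b a] ab by (auto simp: mult.commute)
  qed
  show ?thesis
  proof (intro ex1I[of _ m'] conjI lc irr m'x)
    fix p :: "'a poly"
    assume p: "Polynomial.lead_coeff p = 1 \<and> Factorial_Ring.irreducible p \<and> poly_ac p x = 0"
    hence "m' dvd p" using dvd' by blast
    then obtain k where k: "p = m' * k" by (elim dvdE)
    hence "is_unit k"
      using p not_unit[OF m'x] Factorial_Ring.irreducibleD by blast
    then obtain e where e: "k = [:e:]"
      by (auto simp: is_unit_poly_iff)
    have "Polynomial.lead_coeff k = 1"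
      using p lc by (simp add: k Polynomial.lead_coeff_mult)
    thus "p = m'" using k e by (simp add: pCons_one)
  qed
qed

subsection \<open>The polynomials and sequences of the theorem\<close>

definition g_poly :: "'a :: {field, finite} \<Rightarrow> 'a poly" where
  "g_poly s = (let n = (CARD('a) + 1) div 2 in [:0, 1:] ^ n + (1 - [:0, 1:]) ^ n - [:s:])"

definition quad_char :: "'a :: field \<Rightarrow> int" where
  "quad_char a = (if a = 0 then 0 else if \<exists>b. a = b\<^sup>2 then 1 else - 1)"

definition C_set :: "'a :: field set" where
  "C_set = {a. quad_char a = 1 \<and> quad_char (1 - a) = 1}"

text \<open>The definite description is justified by \<open>ex1_c_seq\<close> below.\<close>

definition c_seq :: "'a :: field \<Rightarrow> int \<Rightarrow> 'a" where
  "c_seq c = (THE u. u 0 = 0 \<and> u 1 = c \<and>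
                (\<forall>k. u (k + 1) = (2 - 4 * c) * u k - u (k - 1) + 2 * c))"

fun c_seq_nat :: "'a :: field \<Rightarrow> nat \<Rightarrow> 'a" where
  "c_seq_nat c 0 = 0"
| "c_seq_nat c (Suc 0) = c"
| "c_seq_nat c (Suc (Suc k)) = (2 - 4 * c) * c_seq_nat c (Suc k) - c_seq_nat c k + 2 * c"

lemma ex1_c_seq:
  fixes c :: "'a :: field"
  shows "\<exists>!u :: int \<Rightarrow> 'a. u 0 = 0 \<and> u 1 = c \<and>
           (\<forall>k. u (k + 1) = (2 - 4 * c) * u k - u (k - 1) + 2 * c)"
proof (rule ex1I)
  define v where "v = (\<lambda>k :: int. c_seq_nat c (nat \<bar>k\<bar>))"
  have "v (k + 1) = (2 - 4 * c) * v k - v (k - 1) + 2 * c" for k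
  proof -
    consider j where "k = int (Suc j)" | "k = 0" | j where "k = - int (Suc j)"
    proof (cases k rule: int_cases3)
      case (pos n)
      thus ?thesis using that(1)[of "n - 1"] by simp
    next
      case (neg n)
      thus ?thesis using that(3)[of "n - 1"] by simp
    qed (use that(2) in simp)
    thus ?thesis
    proof cases
      case (1 j)
      have "nat \<bar>k + 1\<bar> = Suc (Suc j)" "nat \<bar>k\<bar> = Suc j" "nat \<bar>k - 1\<bar> = j"
        using 1 by auto
      thus ?thesis by (simp add: v_def)
    next
      case 2
      thus ?thesis by (simp add: v_def)
    next
      case (3 j)
      have "nat \<bar>k + 1\<bar> = j" "nat \<bar>k\<bar> = Suc j" "nat \<bar>k - 1\<bar> = Suc (Suc j)"
        using 3 by auto
      thus ?thesis by (simp add: v_def)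
    qed
  qed
  thus "v 0 = 0 \<and> v 1 = c \<and> (\<forall>k. v (k + 1) = (2 - 4 * c) * v k - v (k - 1) + 2 * c)"
    by (simp add: v_def)
  fix u :: "int \<Rightarrow> 'a"
  assume u: "u 0 = 0 \<and> u 1 = c \<and> (\<forall>k. u (k + 1) = (2 - 4 * c) * u k - u (k - 1) + 2 * c)"
  have down: "u (k - 1) = (2 - 4 * c) * u k - u (k + 1) + 2 * c" for k
  proof -
    have "u (k + 1) = (2 - 4 * c) * u k - u (k - 1) + 2 * c" using u by blast
    thus ?thesis by simp
  qed
  have pos: "u (int j) = c_seq_nat c j \<and> u (int (Suc j)) = c_seq_nat c (Suc j)" for j
  proof (induction j)
    case (Suc j)
    have "u (int (Suc j) + 1) = (2 - 4 * c) * u (int (Suc j)) - u (int (Suc j) - 1) + 2 * c"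
      using u by blast
    with Suc show ?case by (simp add: add.commute)
  qed (use u in auto)
  have neg: "u (- int j) = c_seq_nat c j \<and> u (- int (Suc j)) = c_seq_nat c (Suc j)" for j
  proof (induction j)
    case 0
    show ?case using u down[of 0] by simp
  next
    case (Suc j)
    have "- int (Suc j) + 1 = - int j" "- int (Suc j) - 1 = - int (Suc (Suc j))"
      by simp_all
    with Suc down[of "- int (Suc j)"] show ?case by simp
  qed
  show "u = v"
  proof
    fix k :: int
    show "u k = v k"
      using pos[of "nat k"] neg[of "nat (- k)"] by (cases "k \<ge> 0") (auto simp: v_def)
  qed
qed

text \<open>In both branches the division by 2 is exact whenever \<open>d > 0\<close>.\<close>

definition N_poly :: "'a :: field \<Rightarrow> nat \<Rightarrow> 'a poly" where
  "N_poly c d =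
     (if odd d
      then [:0, 1:] * (\<Prod>k = 1..(d - 1) div 2. ([:0, 1:] - [:c_seq c (int k):])\<^sup>2)
      else ([:0, 1:]\<^sup>2 - [:0, 1:]) * (\<Prod>k = 1..(d - 2) div 2. ([:0, 1:] - [:c_seq c (int k):])\<^sup>2))"

end

theory Submission
  imports Defs "HOL-Number_Theory.Residues"
begin

text \<open>
  Write \<open>K\<close> for the algebraic closure and \<open>h w = (w + 1)\<^sup>2 / (4 * w)\<close>, a map under which every
  element of \<open>K\<close> is the image of a pair \<open>w, 1/w\<close> of nonzero elements (\<open>joukowski\<close> below). Choose \<open>w\<close> and \<open>m\<close> in
  \<open>K\<close> with \<open>h w = x\<close> and \<open>h m = s\<^sup>2\<close>. Everything in sight becomes multiplication by \<open>m\<close>.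

  The equation \<open>x ^ n + (1 - x) ^ n = s\<close> with \<open>2 * n = q + 1\<close>, squared twice, turns into a
  quadratic equation for \<open>x ^ q\<close> whose coefficients depend on \<open>x\<close> and \<open>s\<^sup>2\<close>
  (\<open>g_poly_root_relation\<close>). It is the addition law of \<open>h\<close>: its solutions are \<open>h (m * w)\<close> and
  \<open>h (w / m)\<close> (\<open>joukowski_addition\<close>). After replacing \<open>w\<close> by \<open>1/w\<close> if necessary,
  \<open>x ^ q = h (m * w)\<close>, and for \<open>d > 2\<close> this iterates: the \<open>k\<close>-th Frobenius conjugate of \<open>x\<close> is
  \<open>h (m ^ k * w)\<close> (\<open>frob_funpow_joukowski\<close>). Since \<open>x\<close> has exactly \<open>d > 2\<close> conjugates, \<open>m\<close> is a
  primitive \<open>d\<close>-th root of unity.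

  On the other hand \<open>c = 1 - s\<^sup>2 = h (- m)\<close>, and the recurrence for the \<open>c\<^sub>k\<close> comes from the same
  addition law, so \<open>c\<^sub>k = h (- (m ^ k))\<close>. The symmetry \<open>c\<^sub>k = c\<^bsub>d-k\<^esub>\<close> explains the squares in
  the definition of \<open>N\<close>: over \<open>K\<close>, \<open>N\<close> is the product of \<open>y - h (- (m ^ k))\<close> over one full cycle
  \<open>0 \<le> k < d\<close> (\<open>N_poly_eq_prod\<close>). Consequently \<open>N (h w)\<close> does not change when \<open>w\<close> is replaced by
  \<open>m * w\<close> (\<open>prod_joukowski_invariant\<close>); explicitly it is
  \<open>(w ^ d + w ^ (-d) - 2 * (-1) ^ d) / 4 ^ d\<close>. Hence \<open>N (x ^ q) = N x\<close>, so the value \<open>N x\<close> is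
  fixed by the Frobenius map and lies in the ground field. Then \<open>N - N x\<close> is a monic polynomial of
  degree \<open>d\<close> over the ground field that vanishes at \<open>x\<close>, which can only be the minimal polynomial.
\<close>

section \<open>A rational parametrization\<close>

text \<open>
  This is \<open>(t + 1) / 2\<close> for \<open>t = (w + 1/w) / 2\<close>, in other words the square of the cosine of half
  the angle of \<open>w\<close>. The affine normalization sends the branch points \<open>-1\<close> and \<open>1\<close> to \<open>0\<close> and
  \<open>1\<close>, the points that the substitution of \<open>1 - y\<close> for \<open>y\<close> exchanges.
\<close>

definition joukowski :: "'b :: field \<Rightarrow> 'b" where
  "joukowski w = (w + 1)\<^sup>2 / (4 * w)"

lemma four_nonzero: "(2 :: 'b :: field) \<noteq> 0 \<Longrightarrow> (4 :: 'b) \<noteq> 0"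
proof -
  assume "(2 :: 'b) \<noteq> 0"
  hence "(2 :: 'b) * 2 \<noteq> 0" by (simp only: mult_eq_0_iff simp_thms)
  thus ?thesis by simp
qed

lemma joukowski_diff:
  fixes v w :: "'b :: field"
  assumes "(2 :: 'b) \<noteq> 0" "v \<noteq> 0" "w \<noteq> 0"
  shows "joukowski w - joukowski v = (w - v) * (w * v - 1) / (4 * w * v)"
proof -
  have "joukowski w - joukowski v = ((w + 1)\<^sup>2 * v - (v + 1)\<^sup>2 * w) / (4 * w * v)"
    using assms four_nonzero[OF assms(1)] by (simp add: joukowski_def diff_frac_eq divide_simps)
  also have "(w + 1)\<^sup>2 * v - (v + 1)\<^sup>2 * w = (w - v) * (w * v - 1)"
    by (simp add: algebra_simps power2_eq_square)
  finally show ?thesis .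
qed

lemma joukowski_eq_iff:
  fixes v w :: "'b :: field"
  assumes "(2 :: 'b) \<noteq> 0" "v \<noteq> 0" "w \<noteq> 0"
  shows "joukowski w = joukowski v \<longleftrightarrow> w = v \<or> w * v = 1"
proof -
  have "joukowski w - joukowski v = 0 \<longleftrightarrow> w = v \<or> w * v = 1"
    using assms four_nonzero[OF assms(1)] by (subst joukowski_diff) auto
  thus ?thesis by simp
qed

lemma joukowski_inverse:
  fixes w :: "'b :: field"
  assumes "(2 :: 'b) \<noteq> 0" "w \<noteq> 0"
  shows "joukowski (inverse w) = joukowski w"
  using assms by (subst joukowski_eq_iff) auto

lemma joukowski_uminus:
  fixes w :: "'b :: field"
  assumes "(2 :: 'b) \<noteq> 0" "w \<noteq> 0"
  shows "joukowski (- w) = 1 - joukowski w"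
proof -
  show ?thesis
    using assms four_nonzero[OF assms(1)] by (simp add: joukowski_def divide_simps) (simp add: algebra_simps power2_eq_square)
qed

lemma joukowski_surj:
  fixes y :: "'b :: alg_closed_field"
  assumes "(2 :: 'b) \<noteq> 0"
  obtains w where "w \<noteq> 0" "joukowski w = y"
proof -
  note four = four_nonzero[OF assms]
  obtain w where w: "poly [:1, 2 - 4 * y, 1:] w = 0"
    using alg_closed_imp_poly_has_root[of "[:1, 2 - 4 * y, 1:]"] by auto
  hence "w \<noteq> 0" by auto
  moreover from this w four have "joukowski w = y"
    by (simp add: joukowski_def divide_simps) (simp add: algebra_simps power2_eq_square)
  ultimately show ?thesis using that by blast
qed

text \<open>
  In terms of angles the hypothesis is the relation between the squared cosines of three angles of
  which one is the sum or the difference of the other two. It is monic quadratic in \<open>y\<close>, so it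
  suffices to match the sum and the product of the two claimed solutions with its coefficients.
\<close>

lemma joukowski_addition:
  fixes m w y :: "'b :: field"
  assumes "(2 :: 'b) \<noteq> 0" "m \<noteq> 0" "w \<noteq> 0"
    and "(joukowski m - joukowski w * y - (1 - joukowski w) * (1 - y))\<^sup>2
           = 4 * (joukowski w * y * ((1 - joukowski w) * (1 - y)))"
  shows "y = joukowski (m * w) \<or> y = joukowski (m * inverse w)"
proof -
  note four = four_nonzero[OF assms(1)]
  define a b where "a = joukowski m" and "b = joukowski w"
  have sum: "joukowski (m * w) + joukowski (m * inverse w) = 2 - 2 * a - 2 * b + 4 * a * b"
    using four assms(2,3)
    by (simp add: a_def b_def joukowski_def divide_simps) (simp add: algebra_simps power2_eq_square)
  have "joukowski (m * w) * joukowski (m * inverse w) = ((m * w + 1) * (m + w) / (4 * m * w))\<^sup>2"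
    using four assms(2,3)
    by (simp add: joukowski_def divide_simps) (simp add: algebra_simps power2_eq_square)
  also have "(m * w + 1) * (m + w) / (4 * m * w) = a + b - 1"
    using four assms(2,3)
    by (simp add: a_def b_def joukowski_def divide_simps) (simp add: algebra_simps power2_eq_square)
  finally have prod: "joukowski (m * w) * joukowski (m * inverse w) = (a + b - 1)\<^sup>2" .
  have "(y - joukowski (m * w)) * (y - joukowski (m * inverse w))
      = y\<^sup>2 - (joukowski (m * w) + joukowski (m * inverse w)) * y
        + joukowski (m * w) * joukowski (m * inverse w)"
    by (simp add: algebra_simps power2_eq_square)
  also have "\<dots> = (a - b * y - (1 - b) * (1 - y))\<^sup>2 - 4 * (b * y * ((1 - b) * (1 - y)))"
    unfolding sum prod by (simp add: algebra_simps power2_eq_square)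
  also have "\<dots> = 0" using assms(4) by (simp add: a_def b_def)
  finally show ?thesis by simp
qed

section \<open>Products over a cycle\<close>

lemma prod_lessThan_shift_cyclic:
  fixes f :: "nat \<Rightarrow> 'b :: comm_monoid_mult"
  assumes "f d = f 0"
  shows "(\<Prod>k<d. f (Suc k)) = (\<Prod>k<d. f k)"
proof (cases d)
  case (Suc n)
  have "(\<Prod>k<d. f k) = f 0 * (\<Prod>k<n. f (Suc k))"
    unfolding Suc by (rule prod.lessThan_Suc_shift)
  also have "\<dots> = (\<Prod>k<d. f (Suc k))"
    using assms by (simp add: Suc mult.commute)
  finally show ?thesis by simp
qed simp

text \<open>
  Each factor on the right is \<open>(w + m ^ k) * (m ^ k * w + 1)\<close> up to the denominator. Passing from
  \<open>w\<close> to \<open>m * w\<close> shifts the exponents by one place, apart from factors \<open>m\<close> that multiply to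
  \<open>m ^ d = 1\<close>; a product over a full period of exponents does not notice such a
  shift.
\<close>

lemma prod_joukowski_invariant:
  fixes m w :: "'b :: field"
  assumes "(2 :: 'b) \<noteq> 0" "w \<noteq> 0" "m ^ d = 1" "d > 0"
  shows "(\<Prod>k<d. joukowski (m * w) - joukowski (- (m ^ k)))
       = (\<Prod>k<d. joukowski w - joukowski (- (m ^ k)))"
proof -
  have m: "m \<noteq> 0" using assms by (auto simp: power_0_left)
  have diff: "joukowski v - joukowski (- (m ^ k))
      = (v + m ^ k) * (m ^ k * v + 1) / (4 * m ^ k * v)" if "v \<noteq> 0" for v k
  proof -
    have "joukowski v - joukowski (- (m ^ k))
        = - ((v + m ^ k) * (m ^ k * v + 1)) / - (4 * m ^ k * v)"
      using that m assms(1) by (subst joukowski_diff) (auto simp: algebra_simps)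
    thus ?thesis by (simp only: minus_divide_divide)
  qed
  have "(\<Prod>k<d. joukowski (m * w) - joukowski (- (m ^ k)))
      = (\<Prod>k<d. m * w + m ^ k) * (\<Prod>k<d. m ^ Suc k * w + 1) / (\<Prod>k<d. 4 * m ^ Suc k * w)"
    using m assms(2)
    by (simp add: diff prod.distrib prod_dividef mult_ac)
  also have "(\<Prod>k<d. m * w + m ^ k) = (\<Prod>k<d. m * w + m ^ Suc k)"
    by (rule prod_lessThan_shift_cyclic[symmetric]) (simp add: assms)
  also have "\<dots> = (\<Prod>k<d. m * (w + m ^ k))"
    by (simp add: algebra_simps)
  also have "\<dots> = (\<Prod>k<d. w + m ^ k)"
    using assms(3) by (simp add: prod.distrib)
  also have "(\<Prod>k<d. m ^ Suc k * w + 1) = (\<Prod>k<d. m ^ k * w + 1)"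
    by (rule prod_lessThan_shift_cyclic) (simp add: assms)
  also have "(\<Prod>k<d. 4 * m ^ Suc k * w) = (\<Prod>k<d. 4 * m ^ k * w)"
    by (rule prod_lessThan_shift_cyclic) (simp add: assms)
  also have "(\<Prod>k<d. w + m ^ k) * (\<Prod>k<d. m ^ k * w + 1) / (\<Prod>k<d. 4 * m ^ k * w)
      = (\<Prod>k<d. joukowski w - joukowski (- (m ^ k)))"
    using assms(2) by (simp add: diff prod.distrib prod_dividef)
  finally show ?thesis .
qed

lemma prod_palindromic_odd:
  fixes f :: "nat \<Rightarrow> 'b :: comm_monoid_mult"
  assumes "\<And>k. 0 < k \<Longrightarrow> k < 2 * n + 1 \<Longrightarrow> f (2 * n + 1 - k) = f k"
  shows "(\<Prod>k<2 * n + 1. f k) = f 0 * (\<Prod>k=1..n. f k * f k)"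
proof -
  have "{..<2 * n + 1} = insert 0 ({1..n} \<union> {n+1..2*n})" by auto
  hence "(\<Prod>k<2 * n + 1. f k) = f 0 * ((\<Prod>k=1..n. f k) * (\<Prod>k=n+1..2*n. f k))"
    by (simp add: prod.union_disjoint)
  also have "(\<Prod>k=n+1..2*n. f k) = (\<Prod>k=1..n. f k)"
    by (rule prod.reindex_bij_witness[of _ "\<lambda>k. 2 * n + 1 - k" "\<lambda>k. 2 * n + 1 - k"])
       (use assms in auto)
  finally show ?thesis by (simp add: prod.distrib)
qed

lemma prod_palindromic_even:
  fixes f :: "nat \<Rightarrow> 'b :: comm_monoid_mult"
  assumes "\<And>k. 0 < k \<Longrightarrow> k < 2 * n + 2 \<Longrightarrow> f (2 * n + 2 - k) = f k"
  shows "(\<Prod>k<2 * n + 2. f k) = f 0 * f (n + 1) * (\<Prod>k=1..n. f k * f k)"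
proof -
  have "{..<2 * n + 2} = insert 0 (insert (n + 1) ({1..n} \<union> {n+2..2*n+1}))" by auto
  hence "(\<Prod>k<2 * n + 2. f k) = f 0 * (f (n + 1) * ((\<Prod>k=1..n. f k) * (\<Prod>k=n+2..2*n+1. f k)))"
    by (simp add: prod.union_disjoint)
  also have "(\<Prod>k=n+2..2*n+1. f k) = (\<Prod>k=1..n. f k)"
    by (rule prod.reindex_bij_witness[of _ "\<lambda>k. 2 * n + 2 - k" "\<lambda>k. 2 * n + 2 - k"])
       (use assms in auto)
  finally show ?thesis by (simp add: prod.distrib mult_ac)
qed

section \<open>Polynomials over the ground field\<close>

lemma map_poly_to_ac_diff: "map_poly to_ac (p - q) = map_poly to_ac p - map_poly to_ac q"
  by (rule poly_eqI) (simp add: coeff_map_poly)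

lemma map_poly_to_ac_power: "map_poly to_ac (p ^ n) = map_poly to_ac p ^ n"
  by (induction n) (simp_all add: map_poly_to_ac_mult)

lemma map_poly_to_ac_prod: "map_poly to_ac (\<Prod>k\<in>A. f k) = (\<Prod>k\<in>A. map_poly to_ac (f k))"
  by (induction A rule: infinite_finite_induct) (simp_all add: map_poly_to_ac_mult)

lemma degree_map_poly_to_ac: "Polynomial.degree (map_poly to_ac p) = Polynomial.degree p"
  by (rule degree_map_poly) simp

lemma min_poly_props:
  "Polynomial.lead_coeff (min_poly x) = 1" "Factorial_Ring.irreducible (min_poly x)"
  "poly_ac (min_poly x) x = 0"
  using theI'[OF ex1_monic_irreducible[of x]] unfolding min_poly_def by blast+

text \<open>
  Descent: the remainder of the minimal polynomial modulo an annihilating polynomial of smaller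
  degree would be annihilating of still smaller degree, and by irreducibility it is not zero.
\<close>

lemma ac_degree_le:
  assumes "p \<noteq> 0" "poly_ac p x = 0"
  shows "ac_degree x \<le> Polynomial.degree p"
  using assms
proof (induction "Polynomial.degree p" arbitrary: p rule: less_induct)
  case less
  let ?m = "min_poly x"
  show ?case
  proof (rule ccontr)
    assume "\<not> ac_degree x \<le> Polynomial.degree p"
    hence deg: "Polynomial.degree p < Polynomial.degree ?m"
      by (simp add: ac_degree_def)
    have "map_poly to_ac ?m = map_poly to_ac (?m div p) * map_poly to_ac p + map_poly to_ac (?m mod p)"
      by (simp flip: map_poly_to_ac_add map_poly_to_ac_mult)
    hence root: "poly_ac (?m mod p) x = 0"
      using less.prems min_poly_props(3)[of x] by simp
    show False
    proof (cases "?m mod p = 0")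
      case False
      have "Polynomial.degree (?m mod p) < Polynomial.degree p"
        using degree_mod_less[OF less.prems(1), of ?m] False by blast
      from less.hyps[OF this False root] this deg show False by (simp add: ac_degree_def)
    next
      case True
      then obtain k where k: "?m = p * k" by (auto simp: mod_eq_0_iff_dvd)
      have "\<not> is_unit p"
      proof
        assume "is_unit p"
        then obtain c where "p = [:c:]" "c \<noteq> 0"
          by (auto simp: is_unit_poly_iff dvd_field_iff)
        with less.prems show False by (simp add: map_poly_pCons)
      qed
      hence "is_unit k"
        using k min_poly_props(2)[of x] Factorial_Ring.irreducibleD by blast
      then obtain c where "k = [:c:]" by (auto simp: is_unit_poly_iff)
      hence "Polynomial.degree ?m \<le> Polynomial.degree p"
        using k by simp
      with deg show False by simp
    qed
  qed
qed

lemma min_poly_unique: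
  assumes "Polynomial.lead_coeff p = 1" "Polynomial.degree p = ac_degree x" "poly_ac p x = 0"
  shows "p = min_poly x"
proof (rule ccontr)
  assume neq: "p \<noteq> min_poly x"
  let ?r = "p - min_poly x"
  have "Polynomial.degree ?r \<le> ac_degree x"
    using assms(2) by (intro degree_diff_le) (simp_all add: ac_degree_def)
  moreover have "poly.coeff ?r (ac_degree x) = 0"
    using assms(1,2) min_poly_props(1)[of x] by (simp add: ac_degree_def)
  moreover have "ac_degree x \<le> Polynomial.degree ?r"
    using neq assms(3) min_poly_props(3)[of x]
    by (intro ac_degree_le) (simp_all add: map_poly_to_ac_diff)
  ultimately have "Polynomial.lead_coeff ?r = 0" by (metis le_antisym)
  hence "?r = 0" by (simp only: leading_coeff_0_iff)
  with neq show False by simp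
qed

section \<open>The Frobenius map\<close>

definition frob :: "'a :: {field, finite} alg_closure \<Rightarrow> 'a alg_closure" where
  "frob z = z ^ CARD('a)"

lemma power_CARD_eq_same:
  fixes a :: "'a :: {field, finite}"
  shows "a ^ CARD('a) = a"
proof (cases "a = 0")
  case False
  let ?P = "\<Prod>y\<in>UNIV - {0 :: 'a}. y"
  have "?P = (\<Prod>y\<in>UNIV - {0}. a * y)"
    by (rule prod.reindex_bij_witness[of _ "\<lambda>y. a * y" "\<lambda>y. y / a"]) (use False in auto)
  also have "\<dots> = a ^ (CARD('a) - 1) * ?P"
    by (simp add: prod.distrib card_Diff_singleton)
  finally have "a ^ (CARD('a) - 1) = 1" by simp
  moreover have "a ^ CARD('a) = a * a ^ (CARD('a) - 1)"
    by (simp flip: power_Suc)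
  ultimately show ?thesis by simp
qed (simp add: power_0_left)

lemma frob_to_ac [simp]: "frob (to_ac a) = to_ac a"
  by (simp add: frob_def power_CARD_eq_same flip: to_ac_power)

lemma frob_mult: "frob (y * z) = frob y * frob z"
  by (simp add: frob_def power_mult_distrib)

lemma frob_divide: "frob (y / z) = frob y / frob z"
  by (simp add: frob_def power_divide)

lemma frob_inverse: "frob (inverse z) = inverse (frob z)"
  by (simp add: frob_def power_inverse)

lemma frob_power: "frob (z ^ n) = frob z ^ n"
  by (simp add: frob_def mult.commute flip: power_mult)

lemma frob_0 [simp]: "frob 0 = 0" and frob_1 [simp]: "frob 1 = 1"
  by (simp_all add: frob_def power_0_left)

lemma frob_eq_0_iff [simp]: "frob z = 0 \<longleftrightarrow> z = 0"
  by (simp add: frob_def)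

text \<open>
  The fixed points are roots of \<open>y ^ q - y\<close>, and the \<open>q\<close> elements of the ground field already
  use up all the roots that this polynomial can have.
\<close>

lemma frob_fixed:
  fixes z :: "'a :: {field, finite} alg_closure"
  assumes "frob z = z"
  shows "z \<in> range to_ac"
proof (rule ccontr)
  assume notin: "z \<notin> range to_ac"
  let ?q = "CARD('a)"
  let ?p = "monom 1 ?q + monom (-1) 1 :: 'a alg_closure poly"
  have "card {0, 1 :: 'a} \<le> ?q" by (rule card_mono) simp_all
  hence q: "1 < ?q" by simp
  hence deg: "Polynomial.degree ?p = ?q"
    by (subst degree_add_eq_left) (simp_all add: Polynomial.degree_monom_eq)
  hence p0: "?p \<noteq> 0" using q by auto
  have "insert z (range to_ac) \<subseteq> {y. poly ?p y = 0}"
    using assms by (auto simp: poly_monom frob_def power_CARD_eq_same simp flip: to_ac_power)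
  hence "card (insert z (range (to_ac :: 'a \<Rightarrow> _))) \<le> card {y. poly ?p y = 0}"
    by (intro card_mono poly_roots_finite p0)
  also have "\<dots> \<le> ?q"
    using card_poly_roots_bound[OF p0] deg by simp
  finally show False
    using notin by (simp add: card_image inj_to_ac)
qed

text \<open>
  The cardinality is a power of the characteristic; this is what makes the Frobenius map additive.
\<close>

locale prime_power_field =
  fixes p e :: nat and ty :: "'a :: {field, finite} itself"
  assumes prime_p: "prime p" and card_eq: "CARD('a) = p ^ e"
begin

lemma CHAR_eq: "CHAR('a) = p"
proof -
  have pr: "prime CHAR('a)"
    by (intro prime_CHAR_semidom finite_imp_CHAR_pos) simp
  have "CHAR('a) dvd p ^ e"
    using CHAR_dvd_CARD[where 'a = 'a] card_eq by simp
  hence "CHAR('a) dvd p" using pr prime_dvd_power by blast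
  thus ?thesis using pr prime_p primes_dvd_imp_eq by blast
qed

lemma frob_add: "frob (y + z :: 'a alg_closure) = frob y + frob z"
  unfolding frob_def
  by (rule freshmans_dream'[of _ e]) (simp_all add: CHAR_eq prime_p card_eq)

lemma frob_sum: "frob (\<Sum>k\<in>A. f k :: 'a alg_closure) = (\<Sum>k\<in>A. frob (f k))"
  by (induction A rule: infinite_finite_induct) (simp_all add: frob_add)

lemma frob_minus: "frob (- z :: 'a alg_closure) = - frob z"
  using frob_add[of z "- z"] by (simp add: add_eq_0_iff)

lemma frob_diff: "frob (y - z :: 'a alg_closure) = frob y - frob z"
  using frob_add[of y "- z"] by (simp add: frob_minus)

lemma frob_eq_iff: "frob y = frob z \<longleftrightarrow> y = (z :: 'a alg_closure)"
  using frob_eq_0_iff[of "y - z"] by (simp add: frob_diff)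

lemma frob_funpow_eq_iff: "(frob ^^ k) y = (frob ^^ k) z \<longleftrightarrow> y = (z :: 'a alg_closure)"
  by (induction k) (simp_all add: frob_eq_iff)

lemma frob_joukowski: "frob (joukowski z) = joukowski (frob z :: 'a alg_closure)"
proof -
  have "frob (4 :: 'a alg_closure) = 4"
    using frob_to_ac[of "4 :: 'a"] by simp
  thus ?thesis
    by (simp add: joukowski_def frob_divide frob_power frob_add frob_mult)
qed

lemma frob_poly_ac: "frob (poly_ac f z) = poly_ac f (frob z)"
  for f :: "'a poly"
  by (induction f) (simp_all add: map_poly_pCons frob_add frob_mult)

lemma frob_map_poly_mult:
  "map_poly frob (f * g) = map_poly frob f * map_poly frob (g :: 'a alg_closure poly)"
  by (rule poly_eqI) (simp add: coeff_map_poly coeff_mult frob_sum frob_mult)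

lemma frob_map_poly_prod:
  "map_poly frob (\<Prod>k\<in>A. f k) = (\<Prod>k\<in>A. map_poly frob (f k :: 'a alg_closure poly))"
  by (induction A rule: infinite_finite_induct) (simp_all add: frob_map_poly_mult)

text \<open>
  If the orbit of \<open>x\<close> closes up after \<open>m\<close> steps, the Frobenius map permutes the factors
  \<open>y - x ^ (q ^ k)\<close> for \<open>k < m\<close> cyclically. Their product therefore has coefficients in the ground
  field, and it vanishes at \<open>x\<close>.
\<close>

lemma ac_degree_le_frob_period:
  fixes x :: "'a alg_closure"
  assumes "m > 0" "(frob ^^ m) x = x"
  shows "ac_degree x \<le> m"
proof -
  define P where "P = (\<Prod>k<m. [:- (frob ^^ k) x, 1:])"
  have "map_poly frob P = (\<Prod>k<m. [:- (frob ^^ Suc k) x, 1:])"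
    by (simp add: P_def frob_map_poly_prod map_poly_pCons frob_minus)
  also have "\<dots> = P"
    unfolding P_def by (rule prod_lessThan_shift_cyclic) (use assms in simp)
  finally have fixed: "map_poly frob P = P" .
  have "poly.coeff P i \<in> range to_ac" for i
    using arg_cong[OF fixed, of "\<lambda>Q. poly.coeff Q i"] by (intro frob_fixed) (simp add: coeff_map_poly)
  hence lift: "map_poly to_ac (map_poly of_ac P) = P"
    by (intro poly_eqI) (simp add: coeff_map_poly to_ac_of_ac)
  have degP: "Polynomial.degree P = m"
    unfolding P_def by (subst degree_prod_eq_sum_degree) simp_all
  have "poly P x = 0"
    using assms(1) by (auto simp: P_def poly_prod intro!: prod_zero bexI[of _ 0])
  moreover have "map_poly of_ac P \<noteq> 0"
  proof
    assume "map_poly of_ac P = 0"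
    with lift have "P = 0" by simp
    with degP assms(1) show False by simp
  qed
  ultimately have "ac_degree x \<le> Polynomial.degree (map_poly of_ac P)"
    by (intro ac_degree_le) (simp_all add: lift)
  also have "\<dots> = m"
    using degree_map_poly_to_ac[of "map_poly of_ac P"] lift degP by simp
  finally show ?thesis .
qed

text \<open>
  The whole orbit of \<open>x\<close> consists of roots of the minimal polynomial, so among its first
  \<open>ac_degree x + 1\<close> members there is a repetition. By the preceding bound no repetition is
  possible over a shorter distance than \<open>ac_degree x\<close>.
\<close>

lemma frob_period_ac_degree:
  fixes x :: "'a alg_closure"
  shows "(frob ^^ ac_degree x) x = x"
proof -
  let ?d = "ac_degree x" and ?m = "map_poly to_ac (min_poly x)"
  have m0: "?m \<noteq> 0"
    using min_poly_props(1)[of x] by (auto simp: map_poly_eq_0_iff)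
  have root: "poly ?m ((frob ^^ k) x) = 0" for k
    by (induction k) (simp_all add: min_poly_props(3) flip: frob_poly_ac)
  have "\<not> inj_on (\<lambda>k. (frob ^^ k) x) {..?d}"
  proof
    assume "inj_on (\<lambda>k. (frob ^^ k) x) {..?d}"
    hence "Suc ?d = card ((\<lambda>k. (frob ^^ k) x) ` {..?d})"
      by (simp add: card_image)
    also have "\<dots> \<le> card {y. poly ?m y = 0}"
      using root by (intro card_mono poly_roots_finite m0) auto
    also have "\<dots> \<le> ?d"
      using card_poly_roots_bound[OF m0] by (simp add: degree_map_poly_to_ac ac_degree_def)
    finally show False by simp
  qed
  then obtain i j where ij: "i < j" "j \<le> ?d" "(frob ^^ i) x = (frob ^^ j) x"
    unfolding inj_on_def by (metis atMost_iff linorder_neqE_nat)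
  have "(frob ^^ i) ((frob ^^ (j - i)) x) = (frob ^^ j) x"
    using ij(1) by (simp flip: funpow_add comp_apply[of "frob ^^ i"])
  hence per: "(frob ^^ (j - i)) x = x"
    using ij(3) by (metis frob_funpow_eq_iff)
  hence "?d \<le> j - i"
    using ij(1) by (intro ac_degree_le_frob_period) auto
  with ij have "j - i = ?d" by simp
  with per show ?thesis by simp
qed

section \<open>The Frobenius orbit of a zero\<close>

text \<open>
  Since \<open>joukowski\<close> forgets the difference between a point and its inverse, the hypotheses determine
  \<open>frob m\<close> and \<open>frob w\<close> up to inversion only. If both signs agree, \<open>m ^ k * w\<close> goes to
  \<open>m ^ Suc k * w\<close> up to inversion and the orbit is as claimed. If they disagree, \<open>w\<close> returns to
  itself after two steps, which the degree of \<open>x\<close> excludes.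
\<close>

lemma frob_funpow_joukowski:
  fixes x w m :: "'a alg_closure"
  assumes two: "(2 :: 'a alg_closure) \<noteq> 0" and deg: "ac_degree x > 2"
    and w: "w \<noteq> 0" and m: "m \<noteq> 0"
    and x: "x = joukowski w" and fx: "frob x = joukowski (m * w)"
    and fm: "joukowski m \<in> range to_ac"
  shows "(frob ^^ k) x = joukowski (m ^ k * w)"
proof -
  have not_fixed: "(frob ^^ 2) x \<noteq> x"
    using ac_degree_le_frob_period[of 2 x] deg by auto
  have "joukowski (frob m) = joukowski m"
    using fm by (auto simp flip: frob_joukowski)
  hence M: "frob m = m \<or> frob m = inverse m"
    using two m by (subst (asm) joukowski_eq_iff) (auto simp: field_simps)
  have "joukowski (frob w) = joukowski (m * w)"
    using x fx by (simp flip: frob_joukowski)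
  hence W: "frob w = m * w \<or> frob w = inverse (m * w)"
    using two m w by (subst (asm) joukowski_eq_iff) (auto simp: field_simps)
  have f2: "(frob ^^ 2) x = joukowski (frob (frob w))"
    by (simp add: x eval_nat_numeral frob_joukowski)
  have cases: "frob m = m \<and> frob w = m * w \<or> frob m = inverse m \<and> frob w = inverse (m * w)"
  proof (rule ccontr)
    assume "\<not> ?thesis"
    with M W have "frob (frob w) = w"
      using m w by (auto simp: frob_mult frob_inverse)
    with f2 x not_fixed show False by simp
  qed
  show ?thesis
  proof (induction k)
    case (Suc k)
    have "frob (m ^ k * w) = m ^ Suc k * w \<or> frob (m ^ k * w) = inverse (m ^ Suc k * w)"
      using cases by (auto simp: frob_mult frob_power power_inverse)
    moreover have "m ^ Suc k * w \<noteq> 0" using m w by simp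
    ultimately have "joukowski (frob (m ^ k * w)) = joukowski (m ^ Suc k * w)"
      using joukowski_inverse[OF two] by metis
    with Suc show ?case by (simp add: frob_joukowski)
  qed (simp add: x)
qed

text \<open>
  With \<open>A = x ^ n\<close> and \<open>B = (1 - x) ^ n\<close>, \<open>2 * n = q + 1\<close> gives \<open>A\<^sup>2 = x * frob x\<close> and
  \<open>B\<^sup>2 = (1 - x) * (1 - frob x)\<close>. Squaring \<open>A + B = s\<close> leaves the mixed term \<open>2 * A * B\<close>, and
  squaring once more expresses that term by \<open>A\<^sup>2\<close> and \<open>B\<^sup>2\<close> as well.
\<close>

lemma g_poly_root_relation:
  fixes x :: "'a alg_closure" and s :: 'a
  assumes "odd p" "poly_ac (g_poly s) x = 0"
  shows "(to_ac (s\<^sup>2) - x * frob x - (1 - x) * (1 - frob x))\<^sup>2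
           = 4 * (x * frob x * ((1 - x) * (1 - frob x)))"
proof -
  define n where "n = (CARD('a) + 1) div 2"
  have "odd (CARD('a))" using assms(1) by (simp add: card_eq)
  hence n: "n * 2 = Suc (CARD('a))" by (auto simp: n_def elim!: oddE)
  define A B where "A = x ^ n" and "B = (1 - x) ^ n"
  have square: "(z ^ n)\<^sup>2 = z * frob z" for z :: "'a alg_closure"
    by (simp add: frob_def n flip: power_mult)
  have A: "A\<^sup>2 = x * frob x" and B: "B\<^sup>2 = (1 - x) * (1 - frob x)"
    using square[of x] square[of "1 - x"] by (simp_all add: A_def B_def frob_diff)
  have "g_poly s = [:0, 1:] ^ n + (1 - [:0, 1:]) ^ n - [:s:]"
    unfolding g_poly_def Let_def n_def by (rule refl)
  hence "poly_ac (g_poly s) x = A + B - to_ac s"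
    by (simp add: A_def B_def map_poly_to_ac_diff map_poly_to_ac_add
      map_poly_to_ac_power map_poly_pCons)
  hence s: "to_ac s = A + B" using assms(2) by simp
  have "to_ac (s\<^sup>2) - A\<^sup>2 - B\<^sup>2 = 2 * A * B"
    by (simp add: s power2_eq_square algebra_simps)
  thus ?thesis
    by (simp flip: A B) (simp add: power_mult_distrib)
qed

end

section \<open>The polynomial N\<close>

lemma c_seq_props:
  "c_seq c 0 = 0" "c_seq c 1 = c"
  "c_seq c (k + 1) = (2 - 4 * c) * c_seq c k - c_seq c (k - 1) + 2 * c"
  using theI'[OF ex1_c_seq[of c]] unfolding c_seq_def by blast+

text \<open>
  This is the identity \<open>cos (a + b) + cos (a - b) = 2 * cos a * cos b\<close> in the present
  normalization.
\<close>

lemma joukowski_recurrence: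
  fixes u v :: "'b :: field"
  assumes "(2 :: 'b) \<noteq> 0" "u \<noteq> 0" "v \<noteq> 0"
  shows "joukowski (- (u * v)) = (2 - 4 * joukowski (- v)) * joukowski (- u)
           - joukowski (- (u / v)) + 2 * joukowski (- v)"
proof -
  show ?thesis
    using assms four_nonzero[OF assms(1)] by (simp add: joukowski_def divide_simps) (simp add: algebra_simps power2_eq_square)
qed

lemma c_seq_eq_joukowski:
  fixes c :: "'a :: field" and m :: "'a alg_closure"
  assumes "(2 :: 'a alg_closure) \<noteq> 0" "m \<noteq> 0" "to_ac c = joukowski (- m)"
  shows "to_ac (c_seq c (int k)) = joukowski (- (m ^ k))"
proof (induction k rule: less_induct)
  case (less k)
  consider "k = 0" | "k = 1" | j where "k = Suc (Suc j)"
    by (metis One_nat_def not0_implies_Suc)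
  thus ?case
  proof cases
    case 1
    thus ?thesis by (simp add: c_seq_props joukowski_def)
  next
    case 2
    thus ?thesis using c_seq_props(2)[of c] assms(3) by simp
  next
    case (3 j)
    have "to_ac (c_seq c (int k)) =
        (2 - 4 * to_ac c) * to_ac (c_seq c (int (Suc j))) - to_ac (c_seq c (int j)) + 2 * to_ac c"
      using c_seq_props(3)[of c "int (Suc j)"] by (simp add: 3 add.commute)
    also have "\<dots> = joukowski (- (m ^ Suc j * m))"
      using joukowski_recurrence[of "m ^ Suc j" m] assms less[of j] less[of "Suc j"] by (simp add: 3)
    finally show ?thesis by (simp add: 3 mult_ac)
  qed
qed

text \<open>
  Opposite exponents give the same factor. The exponents \<open>0\<close> and, for even \<open>d\<close>, \<open>d / 2\<close> are their
  own opposites modulo \<open>d\<close>; they account for the simple factors \<open>y\<close> and \<open>y - 1\<close> of \<open>N\<close>.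
\<close>

lemma N_poly_eq_prod:
  fixes c :: "'a :: field" and m :: "'a alg_closure"
  assumes two: "(2 :: 'a alg_closure) \<noteq> 0" and m: "m \<noteq> 0" and c: "to_ac c = joukowski (- m)"
    and d: "d > 0" "m ^ d = 1" and half: "even d \<Longrightarrow> m ^ (d div 2) = -1"
  shows "map_poly to_ac (N_poly c d) = (\<Prod>k<d. [:- joukowski (- (m ^ k)), 1:])"
proof -
  define f where "f k = [:- joukowski (- (m ^ k)), 1:]" for k
  have sym: "f (d - k) = f k" if "k < d" for k
  proof -
    have "m ^ (d - k) * m ^ k = 1" using that d by (simp flip: power_add)
    hence "joukowski (- (m ^ (d - k))) = joukowski (- (m ^ k))"
      using two m by (subst joukowski_eq_iff) auto
    thus ?thesis by (simp add: f_def)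
  qed
  have f0: "f 0 = [:0, 1:]" by (simp add: f_def joukowski_def)
  have lin: "map_poly to_ac ([:0, 1:] - [:c_seq c (int k):]) = f k" for k
    using c_seq_eq_joukowski[OF two m c] by (simp add: f_def map_poly_pCons)
  show ?thesis
  proof (cases "odd d")
    case True
    then obtain n where n: "d = 2 * n + 1" by (auto elim: oddE)
    have "(\<Prod>k<d. f k) = f 0 * (\<Prod>k=1..n. f k * f k)"
      unfolding n by (rule prod_palindromic_odd) (use sym n in auto)
    thus ?thesis
      unfolding N_poly_def using lin f0
      by (simp add: n map_poly_to_ac_mult map_poly_to_ac_prod map_poly_to_ac_power
        map_poly_pCons power2_eq_square f_def)
  next
    case False
    then obtain n' where "d = 2 * n'" by auto
    with d(1) obtain n where n: "d = 2 * n + 2" by (cases n') auto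
    have "f (n + 1) = [:-1, 1:]"
      using half False four_nonzero[OF two] by (simp add: f_def n joukowski_def power2_eq_square)
    moreover have "(\<Prod>k<d. f k) = f 0 * f (n + 1) * (\<Prod>k=1..n. f k * f k)"
      unfolding n by (rule prod_palindromic_even) (use sym n in auto)
    ultimately show ?thesis
      unfolding N_poly_def using lin f0
      by (simp add: n map_poly_to_ac_mult map_poly_to_ac_prod map_poly_to_ac_power
        map_poly_to_ac_diff map_poly_pCons power2_eq_square f_def)
  qed
qed

section \<open>The minimal polynomial\<close>

theorem theorem4p5:
  fixes p e d :: nat and s c :: "'a :: {field, finite}" and x :: "'a alg_closure"
  assumes "prime p" and "odd p" and "CARD('a) = p ^ e"
    and "c = 1 - s\<^sup>2" and "c \<in> C_set"
    and "poly_ac (g_poly s) x = 0"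
    and "d = ac_degree x" and "d > 2"
  shows "map_poly to_ac (min_poly x) =
           map_poly to_ac (N_poly c d) - [:poly_ac (N_poly c d) x:]"
proof -
  interpret prime_power_field p e "TYPE('a)"
    by unfold_locales (use assms in auto)
  have two: "(2 :: 'a alg_closure) \<noteq> 0"
  proof
    assume "(2 :: 'a alg_closure) = 0"
    hence "of_nat 2 = (0 :: 'a alg_closure)" by simp
    hence "p dvd 2" by (simp only: of_nat_eq_0_iff_char_dvd CHAR_alg_closure CHAR_eq)
    with assms(1,2) show False
      using primes_dvd_imp_eq two_is_prime_nat by blast
  qed
  have moved: "(frob ^^ k) x \<noteq> x" if "0 < k" "k < d" for k
    using ac_degree_le_frob_period[of k x] that assms(7) by auto
  obtain m where m: "m \<noteq> 0" "joukowski m = to_ac (s\<^sup>2)"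
    using joukowski_surj[OF two] by metis
  obtain w0 where w0: "w0 \<noteq> 0" "joukowski w0 = x"
    using joukowski_surj[OF two] by metis
  have "frob x = joukowski (m * w0) \<or> frob x = joukowski (m * inverse w0)"
    using g_poly_root_relation[OF assms(2,6)] m w0 two by (intro joukowski_addition) auto
  then obtain w where w: "w \<noteq> 0" "x = joukowski w" "frob x = joukowski (m * w)"
    using w0 joukowski_inverse[OF two w0(1)] nonzero_imp_inverse_nonzero[OF w0(1)] by metis
  have orbit: "(frob ^^ k) x = joukowski (m ^ k * w)" for k
    using assms(7,8) m w two by (intro frob_funpow_joukowski) (auto simp del: to_ac_power)
  \<comment> \<open>The \<open>d\<close>-th conjugate being \<open>x\<close> itself could also mean \<open>m ^ d * w = 1/w\<close>. That would hold for
      \<open>m * w\<close> in place of \<open>w\<close> too, as the next conjugate has the same period; together this forces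
      \<open>m\<^sup>2 = 1\<close>, and then \<open>x\<close> has at most two conjugates.\<close>
  have md: "m ^ d = 1"
  proof (rule ccontr)
    assume neq: "m ^ d \<noteq> 1"
    have fixed: "(frob ^^ d) x = x" using frob_period_ac_degree assms(7) by simp
    have "joukowski (m ^ d * w) = joukowski w"
      using orbit[of d] fixed w(2) by simp
    hence 1: "m ^ d * w\<^sup>2 = 1"
      using two m(1) w(1) neq by (subst (asm) joukowski_eq_iff) (auto simp: power2_eq_square mult_ac)
    have "joukowski (m ^ Suc d * w) = joukowski (m * w)"
      using orbit[of "Suc d"] fixed w(3) by simp
    hence "m ^ Suc d * w * (m * w) = 1"
      using two m(1) w(1) neq by (subst (asm) joukowski_eq_iff) auto
    hence "m\<^sup>2 * (m ^ d * w\<^sup>2) = 1"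
      by (simp add: power2_eq_square mult_ac)
    hence "(frob ^^ 2) x = x"
      unfolding 1 using orbit[of 2] w(2) by simp
    with moved[of 2] assms(8) show False by simp
  qed
  have half: "m ^ (d div 2) = -1" if "even d"
  proof -
    have "(m ^ (d div 2))\<^sup>2 = 1"
      using that md by (simp flip: power_mult)
    moreover have "m ^ (d div 2) \<noteq> 1"
      using moved[of "d div 2"] orbit[of "d div 2"] w(2) assms(8) by auto
    ultimately show ?thesis by (simp add: power2_eq_1_iff)
  qed
  have "to_ac c = joukowski (- m)"
    using m assms(4) by (simp add: joukowski_uminus[OF two])
  hence N: "map_poly to_ac (N_poly c d) = (\<Prod>k<d. [:- joukowski (- (m ^ k)), 1:])"
    using two m(1) md half assms(8) by (intro N_poly_eq_prod) auto
  have "poly_ac (N_poly c d) (joukowski (m * w)) = poly_ac (N_poly c d) (joukowski w)"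
    using prod_joukowski_invariant[OF two w(1) md] assms(8) by (simp add: N poly_prod)
  hence "frob (poly_ac (N_poly c d) x) = poly_ac (N_poly c d) x"
    unfolding w(2)[symmetric] w(3)[symmetric] frob_poly_ac .
  from frob_fixed[OF this] obtain a where a: "poly_ac (N_poly c d) x = to_ac a"
    by (rule rangeE)
  have "Polynomial.degree (map_poly to_ac (N_poly c d)) = d"
    unfolding N by (subst degree_prod_eq_sum_degree) simp_all
  hence degN: "Polynomial.degree (N_poly c d) = d"
    by (simp only: degree_map_poly_to_ac)
  have "to_ac (Polynomial.lead_coeff (N_poly c d)) = Polynomial.lead_coeff (map_poly to_ac (N_poly c d))"
    by (simp add: degree_map_poly_to_ac coeff_map_poly)
  also have "\<dots> = 1"
    unfolding N by (simp add: lead_coeff_prod)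
  finally have lcN: "Polynomial.lead_coeff (N_poly c d) = 1" by simp
  have deg: "Polynomial.degree (N_poly c d - [:a:]) = d"
    unfolding diff_conv_add_uminus
    using degN assms(8) by (subst degree_add_eq_left) simp_all
  have min: "N_poly c d - [:a:] = min_poly x"
  proof (rule min_poly_unique)
    have "poly.coeff [:a:] d = 0"
      using assms(8) by (simp add: coeff_eq_0)
    thus "Polynomial.lead_coeff (N_poly c d - [:a:]) = 1"
      using lcN unfolding deg degN by simp
    show "poly_ac (N_poly c d - [:a:]) x = 0"
      using a by (simp add: map_poly_to_ac_diff map_poly_pCons)
    show "Polynomial.degree (N_poly c d - [:a:]) = ac_degree x"
      using deg assms(7) by (rule trans)
  qed
  show ?thesis
    unfolding min[symmetric] a by (simp add: map_poly_to_ac_diff map_poly_pCons)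
qed

end
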